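(* Let $G=(V,E)$ be a finite directed graph with nonnegative edge distances $d_e$ and losses $l_e$, source $s$ and destination $t$, and for an $s$-$t$ path $P$ let $d(P)=\sum_{e\in P}d_e$, $l(P)=\sum_{e\in P}l_e$, assumed to satisfy $d(P)>0$. Let $\kappa=\frac{20}{\ln 10}$ and $f(P)=l(P)+\kappa\ln d(P)$, and let $(d^*,l^* )$ be the distance-loss pair of a dominant $s$-$t$ path (one minimizing $f$). Fix $r>1$ and $\lambda_0>0$ and set $\lambda_i=\lambda_0 r^i$ for $i\in\mathbb{Z}$. The geometric progression algorithm $\mathrm{GP}_{r,\lambda_0}$ computes, for each $i$, an $s$-$t$ path $P_i$ minimizing $l(P)+\lambda_i d(P)$, and outputs the path among the $P_i$ with smallest $f$. Then the output path $P$ satisfies $$f(P)\le l^*+\kappa\ln d^*+\kappa\left(-1+\frac{\ln r}{r-1}+\ln(r-1)-\ln\ln r\right).$$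
   Context: In the application (indoor dominant path model), $f$ is the modeled path loss in dB up to an additive constant, with $d$ Euclidean path length and $l$ total penetration plus diffraction loss; $\kappa\approx 8.686$ dB. Only finitely many distinct paths exist, so the minimum over the $P_i$ is attained. *)

theory Defs
  imports Complex_Main "Graph_Theory.Graph_Theory"
begin

definition kappa :: real
  where "kappa = 20 / ln 10"

definition path_loss :: "('e \<Rightarrow> real) \<Rightarrow> ('e \<Rightarrow> real) \<Rightarrow> 'e awalk \<Rightarrow> real"
  where "path_loss d l P = wf_digraph.awalk_cost l P + kappa * ln (wf_digraph.awalk_cost d P)"

definition dominant_path ::
    "('v, 'e) pre_digraph \<Rightarrow> ('e \<Rightarrow> real) \<Rightarrow> ('e \<Rightarrow> real) \<Rightarrow> 'v \<Rightarrow> 'v \<Rightarrow> 'e awalk \<Rightarrow> bool"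
  where "dominant_path G d l s t P \<longleftrightarrow>
    is_arg_min (path_loss d l) (\<lambda>Q. pre_digraph.apath G s Q t) P"

text \<open>
  The algorithm does not prescribe how ties are broken, neither among the minimizers for a given
  \<open>i\<close> nor in the final selection, so it is modelled as the relation that holds of every
  path \<open>P\<close> it may output.
\<close>

definition gp_output ::
    "('v, 'e) pre_digraph \<Rightarrow> ('e \<Rightarrow> real) \<Rightarrow> ('e \<Rightarrow> real) \<Rightarrow> 'v \<Rightarrow> 'v \<Rightarrow> real \<Rightarrow> real \<Rightarrow> 'e awalk \<Rightarrow> bool"
  where "gp_output G d l s t r lam0 P \<longleftrightarrow>
    (\<exists>Ps :: int \<Rightarrow> 'e awalk.
      (\<forall>i. is_arg_min
             (\<lambda>Q. wf_digraph.awalk_cost l Q + (lam0 * r powi i) * wf_digraph.awalk_cost d Q)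
             (\<lambda>Q. pre_digraph.apath G s Q t) (Ps i)) \<and>
      is_arg_min (path_loss d l) (\<lambda>Q. Q \<in> range Ps) P)"

end

theory Submission
  imports Defs "HOL-Analysis.Convex"
begin

text \<open>
  Write \<open>\<phi> y = y - 1 - ln y\<close>.  A minimizer of \<open>l + \<lambda> d\<close> exceeds
  the optimum of \<open>l + \<kappa> ln d\<close> by at most \<open>\<kappa> \<phi> (\<lambda> d\<^sup>* / \<kappa>)\<close>, because the logarithm
  lies below its tangents.  The ratios \<open>\<lambda>\<^sub>i d\<^sup>* / \<kappa>\<close> form a geometric progression and therefore
  meet every interval \<open>[a, r a]\<close>.  As \<open>\<phi>\<close> is convex, it is largest at an endpoint of such an
  interval, and \<open>a = ln r / (r - 1)\<close> is the choice for which both endpoints give the same value.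
\<close>

definition ln_tangent_gap :: "real \<Rightarrow> real"
  where "ln_tangent_gap y = y - 1 - ln y"

lemma convex_on_ln_tangent_gap: "convex_on {0<..} ln_tangent_gap"
proof -
  have "convex_on {0<..} (\<lambda>y::real. y - 1)"
    by (intro convex_on_diff) (simp_all add: convex_on_ident concave_on_const)
  then have "convex_on {0<..} (\<lambda>y::real. y - 1 - ln y)"
    using ln_concave by (rule convex_on_diff)
  then show ?thesis
    by (simp add: ln_tangent_gap_def[abs_def])
qed

definition equal_gap_point :: "real \<Rightarrow> real"
  where "equal_gap_point r = ln r / (r - 1)"

lemma equal_gap_point_pos:
  assumes "r > 0" "r \<noteq> 1"
  shows "equal_gap_point r > 0"
  using assms by (simp add: equal_gap_point_def zero_less_divide_iff) linarith

lemma ln_tangent_gap_equal_gap_point: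
  assumes "r > 1"
  shows "ln_tangent_gap (equal_gap_point r) = - 1 + ln r / (r - 1) + ln (r - 1) - ln (ln r)"
  using assms by (simp add: ln_tangent_gap_def equal_gap_point_def ln_div)

lemma ln_tangent_gap_mult_equal_gap_point:
  assumes "r > 0" "r \<noteq> 1"
  shows "ln_tangent_gap (r * equal_gap_point r) = ln_tangent_gap (equal_gap_point r)"
proof -
  have "ln (r * equal_gap_point r) = ln r + ln (equal_gap_point r)"
    using equal_gap_point_pos[OF assms] \<open>r > 0\<close> by (simp add: ln_mult)
  moreover have "(r - 1) * equal_gap_point r = ln r"
    using \<open>r \<noteq> 1\<close> by (simp add: equal_gap_point_def)
  ultimately show ?thesis
    by (simp add: ln_tangent_gap_def algebra_simps)
qed

lemma ln_tangent_gap_le_equal_gap_point: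
  assumes "r > 1" and y: "y \<in> {equal_gap_point r..r * equal_gap_point r}"
  shows "ln_tangent_gap y \<le> ln_tangent_gap (equal_gap_point r)"
proof -
  have "equal_gap_point r > 0"
    using equal_gap_point_pos \<open>r > 1\<close> by simp
  then have "convex_on {equal_gap_point r..r * equal_gap_point r} ln_tangent_gap"
    by (intro convex_on_subset[OF convex_on_ln_tangent_gap]) auto
  from convex_on_le_max[OF this y] show ?thesis
    using \<open>r > 1\<close> by (simp add: ln_tangent_gap_mult_equal_gap_point)
qed

lemma obtain_power_int_between:
  fixes r x :: real
  assumes "r > 1" "x > 0"
  obtains i :: int where "x < r powi i" "r powi i \<le> r * x"
proof
  define i where "i = \<lfloor>log r (r * x)\<rfloor>"
  have "r powr i \<le> r * x" and "r * x < r powr (i + 1)"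
    using floor_log_eq_powr_iff[of "r * x" r i] assms by (simp_all add: i_def)
  then show "r powi i \<le> r * x" and "x < r powi i"
    using assms by (simp_all add: powr_add powr_real_of_int')
qed

lemma arg_min_weighted_sum_ln_le:
  fixes L D :: "'a \<Rightarrow> real"
  assumes min: "is_arg_min (\<lambda>q. L q + w * D q) S p" and "S q"
    and "D p > 0" "D q > 0" "k > 0" "w > 0"
  shows "L p + k * ln (D p) \<le> L q + k * ln (D q) + k * ln_tangent_gap (w * D q / k)"
proof -
  have optimal: "L p + w * D p \<le> L q + w * D q"
    using min \<open>S q\<close> by (simp add: is_arg_min_linorder)
  have "ln (w * D p / k) \<le> w * D p / k - 1"
    using assms by (intro ln_le_minus_one) simp
  then have "k * ln (w * D p / k) \<le> k * (w * D p / k - 1)"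
    using \<open>k > 0\<close> by simp
  then have tangent: "k * ln (D p) \<le> w * D p - k - k * ln (w / k)"
    using assms by (simp add: ln_mult ln_div algebra_simps)
  have "k * ln (D q) + k * ln_tangent_gap (w * D q / k) = w * D q - k - k * ln (w / k)"
    using assms by (simp add: ln_tangent_gap_def ln_mult ln_div algebra_simps)
  with optimal tangent show ?thesis
    by linarith
qed

lemma obtain_geometric_weight_arg_min_ln_le:
  fixes L D :: "'a \<Rightarrow> real" and p :: "int \<Rightarrow> 'a"
  assumes min: "\<And>i. is_arg_min (\<lambda>q. L q + (w * r powi i) * D q) S (p i)" and "S q"
    and pos: "\<And>q. S q \<Longrightarrow> D q > 0" and "k > 0" "w > 0" "r > 1"
  obtains i where "L (p i) + k * ln (D (p i))
    \<le> L q + k * ln (D q) + k * ln_tangent_gap (equal_gap_point r)"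
proof -
  let ?a = "equal_gap_point r"
  have "?a > 0"
    using equal_gap_point_pos \<open>r > 1\<close> by simp
  have "D q > 0"
    using pos \<open>S q\<close> .
  obtain i :: int where i: "?a * k / (w * D q) < r powi i" "r powi i \<le> r * (?a * k / (w * D q))"
    using obtain_power_int_between[of r "?a * k / (w * D q)"]
      \<open>?a > 0\<close> \<open>D q > 0\<close> \<open>k > 0\<close> \<open>w > 0\<close> \<open>r > 1\<close> by auto
  have "w * r powi i * D q / k \<in> {?a..r * ?a}"
    using i \<open>D q > 0\<close> \<open>k > 0\<close> \<open>w > 0\<close> by (simp add: field_simps)
  then have gap: "ln_tangent_gap (w * r powi i * D q / k) \<le> ln_tangent_gap ?a"
    by (rule ln_tangent_gap_le_equal_gap_point[OF \<open>r > 1\<close>])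
  have "S (p i)"
    using min by (simp add: is_arg_min_def)
  have "L (p i) + k * ln (D (p i))
      \<le> L q + k * ln (D q) + k * ln_tangent_gap (w * r powi i * D q / k)"
    using \<open>w > 0\<close> \<open>r > 1\<close>
    by (intro arg_min_weighted_sum_ln_le[OF min \<open>S q\<close> pos[OF \<open>S (p i)\<close>] \<open>D q > 0\<close> \<open>k > 0\<close>]) simp
  also have "\<dots> \<le> L q + k * ln (D q) + k * ln_tangent_gap ?a"
    using gap \<open>k > 0\<close> by simp
  finally show thesis
    by (rule that)
qed

theorem theorem4:
  fixes G :: "('v, 'e) pre_digraph"
    and d l :: "'e \<Rightarrow> real"
    and s t :: 'v
    and r lam0 dstar lstar :: real
    and Pstar P :: "'e awalk"
  assumes "fin_digraph G"
    and "s \<in> verts G" and "t \<in> verts G"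
    and "\<And>e. e \<in> arcs G \<Longrightarrow> d e \<ge> 0"
    and "\<And>e. e \<in> arcs G \<Longrightarrow> l e \<ge> 0"
    and "\<And>Q. pre_digraph.apath G s Q t \<Longrightarrow> wf_digraph.awalk_cost d Q > 0"
    and "dominant_path G d l s t Pstar"
    and "dstar = wf_digraph.awalk_cost d Pstar"
    and "lstar = wf_digraph.awalk_cost l Pstar"
    and "r > 1" and "lam0 > 0"
    and "gp_output G d l s t r lam0 P"
  shows "path_loss d l P \<le> lstar + kappa * ln dstar
           + kappa * (- 1 + ln r / (r - 1) + ln (r - 1) - ln (ln r))"
proof -
  have "kappa > 0"
    by (simp add: kappa_def)
  have apath_Pstar: "pre_digraph.apath G s Pstar t"
    using \<open>dominant_path G d l s t Pstar\<close> by (simp add: dominant_path_def is_arg_min_def)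
  obtain Ps where Ps: "\<And>i. is_arg_min
      (\<lambda>Q. wf_digraph.awalk_cost l Q + (lam0 * r powi i) * wf_digraph.awalk_cost d Q)
      (\<lambda>Q. pre_digraph.apath G s Q t) (Ps i)"
    and P: "is_arg_min (path_loss d l) (\<lambda>Q. Q \<in> range Ps) P"
    using \<open>gp_output G d l s t r lam0 P\<close> unfolding gp_output_def by blast
  obtain i where "path_loss d l (Ps i)
      \<le> path_loss d l Pstar + kappa * ln_tangent_gap (equal_gap_point r)"
    using obtain_geometric_weight_arg_min_ln_le[OF Ps apath_Pstar assms(6) \<open>kappa > 0\<close>
        \<open>lam0 > 0\<close> \<open>r > 1\<close>]
    unfolding path_loss_def by blast
  moreover have "path_loss d l P \<le> path_loss d l (Ps i)"
    using P unfolding is_arg_min_linorder by blast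
  ultimately have "path_loss d l P
      \<le> path_loss d l Pstar + kappa * ln_tangent_gap (equal_gap_point r)"
    by linarith
  then show ?thesis
    by (simp only: path_loss_def assms(8,9) ln_tangent_gap_equal_gap_point[OF \<open>r > 1\<close>])
qed

end
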